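(* Let $I=\mathbb N_0\times\mathbb N$ and $X=c_0(I)$, with dual $X^*=\ell^1(I)$, and let $A:X\rightrightarrows X^*$ be the operator with domain $\operatorname{dom}A=D$ given in the context. Then $A$ has nonempty domain, is maximally monotone in $c_0(I)\times\ell^1(I)$, and is not of type (FPV). More precisely, $$\{x_{0,1}:x\in D\}=(-\infty,-1)\cup(1,+\infty),$$ and the norm closure $\overline{\operatorname{dom}A}$ is not convex.
   Context: Here $\mathbb N=\{1,2,3,\dots\}$, $\mathbb N_0=\mathbb N\cup\{0\}$, $I=\mathbb N_0\times\mathbb N$. All spaces are real. $X=c_0(I)$ is the space of real arrays $x=(x_{b,j})_{b\ge0,j\ge1}$ such that for every $\varepsilon>0$ only finitely many coordinates satisfy $|x_{b,j}|\ge\varepsilon$, with norm $\|x\|_\infty=\sup_{b,j}|x_{b,j}|$. Its dual is $X^*=\ell^1(I)$, with pairing $\langle x,p\rangle=\sum_{b\ge0}\sum_{j\ge1}x_{b,j}p_{b,j}$. Define (empty sums being $0$) $$D=\Bigl\{x\in X:\ |x_{0,1}|>1,\ \sum_{b=1}^{\infty}\sum_{j=1}^{\infty}\Bigl|4^b\Bigl(x_{b,j}+2\sum_{k=1}^{j-1}(-1)^{j-k}x_{b,k}\Bigr)+\frac{2(-1)^{j-1}}{|x_{0,1}|^b}\Bigr|<+\infty\Bigr\}.$$ For $x\in D$, $Ax$ is the singleton (identified with its element of $\ell^1(I)$) with coordinates $$(Ax)_{0,1}=x_{0,1}-\operatorname{sgn}(x_{0,1}),\qquad (Ax)_{0,j}=0\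 \ (j\ge2),$$ $$(Ax)_{b,j}=4^b\Bigl(x_{b,j}+2\sum_{k=1}^{j-1}(-1)^{j-k}x_{b,k}\Bigr)+\frac{2(-1)^{j-1}}{|x_{0,1}|^b}\quad(b\ge1,\ j\ge1).$$ For $x\notin D$, $Ax=\varnothing$. Thus $\operatorname{dom}A=D$. For a real Banach space $X$ and a set-valued operator $A:X\rightrightarrows X^*$, write $\operatorname{gra}A=\{(x,a):a\in Ax\}$ and $\operatorname{dom}A=\{x:Ax\neq\varnothing\}$. $A$ is monotone if $\langle x-y,a-c\rangle\ge0$ for all $(x,a),(y,c)\in\operatorname{gra}A$. A monotone operator $A$ is maximally monotone if every $(z,p)\in X\times X^*$ with $\langle z-x,p-a\rangle\ge0$ for all $(x,a)\in\operatorname{gra}A$ belongs to $\operatorname{gra}A$. A maximally monotone operator $A$ is of type (FPV) if for every open convex set $U\subseteq X$ with $U\cap\operatorname{dom}A\neq\varnothing$ the following holds: whenever $z\in U$, $p\in X^*$ and $\langle z-x,p-a\rangle\ge0$ for every $(x,a)\in\operatorname{gra}A$ with $x\in U$, then $(z,p)\in\operatorname{gra}A$. *)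

theory Defs
  imports "HOL-Analysis.Analysis"
begin

section \<open>Set-valued operators on a real Banach space\<close>

text \<open>The dual of \<open>'a\<close> is \<open>'a \<Rightarrow>\<^sub>L real\<close>; the pairing of \<open>x\<close> and \<open>p\<close> is \<open>blinfun_apply p x\<close>.\<close>

definition gra :: "('a::banach \<Rightarrow> ('a \<Rightarrow>\<^sub>L real) set) \<Rightarrow> ('a \<times> ('a \<Rightarrow>\<^sub>L real)) set" where
  "gra A = {(x, a). a \<in> A x}"

definition op_dom :: "('a::banach \<Rightarrow> ('a \<Rightarrow>\<^sub>L real) set) \<Rightarrow> 'a set" where
  "op_dom A = {x. A x \<noteq> {}}"

definition monotone_op :: "('a::banach \<Rightarrow> ('a \<Rightarrow>\<^sub>L real) set) \<Rightarrow> bool" where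
  "monotone_op A \<longleftrightarrow>
     (\<forall>(x, a) \<in> gra A. \<forall>(y, c) \<in> gra A. blinfun_apply (a - c) (x - y) \<ge> 0)"

definition maximally_monotone :: "('a::banach \<Rightarrow> ('a \<Rightarrow>\<^sub>L real) set) \<Rightarrow> bool" where
  "maximally_monotone A \<longleftrightarrow> monotone_op A \<and>
     (\<forall>z p. (\<forall>(x, a) \<in> gra A. blinfun_apply (p - a) (z - x) \<ge> 0) \<longrightarrow> (z, p) \<in> gra A)"

definition type_FPV :: "('a::banach \<Rightarrow> ('a \<Rightarrow>\<^sub>L real) set) \<Rightarrow> bool" where
  "type_FPV A \<longleftrightarrow> maximally_monotone A \<and>
     (\<forall>U. open U \<and> convex U \<and> U \<inter> op_dom A \<noteq> {} \<longrightarrow>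
        (\<forall>z p. z \<in> U \<and>
           (\<forall>(x, a) \<in> gra A. x \<in> U \<longrightarrow> blinfun_apply (p - a) (z - x) \<ge> 0)
           \<longrightarrow> (z, p) \<in> gra A))"


section \<open>The space of null arrays over the index set\<close>

definition idx :: "(nat \<times> nat) set" where
  "idx = UNIV \<times> {1..}"

text \<open>Arrays over \<open>idx\<close> are functions on \<open>nat \<times> nat\<close> that vanish outside \<open>idx\<close>,
  i.e. at second index \<open>0\<close>.\<close>

typedef c0 = "{x :: nat \<times> nat \<Rightarrow> real.
    (\<forall>i. i \<notin> idx \<longrightarrow> x i = 0) \<and> (\<forall>e>0. finite {i \<in> idx. \<bar>x i\<bar> \<ge> e})}"
  morphisms coord Abs_c0
  by (rule exI[of _ "\<lambda>_. 0"]) auto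

lemma coord_outside: "i \<notin> idx \<Longrightarrow> coord x i = 0"
  using coord[of x] by blast

lemma coord_finite: "e > 0 \<Longrightarrow> finite {i \<in> idx. \<bar>coord x i\<bar> \<ge> e}"
  using coord[of x] by auto

lemma c0_eqI: "(\<And>i. coord x i = coord y i) \<Longrightarrow> x = y"
  by (metis coord_inject ext)

lemma idx_nonempty: "idx \<noteq> {}"
  by (auto simp: idx_def)

lemma coord_bdd: "bdd_above ((\<lambda>i. \<bar>coord x i\<bar>) ` idx)"
proof -
  let ?S = "{i \<in> idx. \<bar>coord x i\<bar> \<ge> 1}"
  have "finite ((\<lambda>i. \<bar>coord x i\<bar>) ` ?S)"
    using coord_finite[of 1 x] by simp
  then obtain M where M: "\<And>i. i \<in> ?S \<Longrightarrow> \<bar>coord x i\<bar> \<le> M"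
    by (metis (no_types, lifting) bdd_above_finite bdd_above.E imageI)
  show ?thesis
  proof (rule bdd_aboveI2[where M = "max 1 M"])
    fix i assume "i \<in> idx"
    then show "\<bar>coord x i\<bar> \<le> max 1 M"
      using M[of i] by (cases "\<bar>coord x i\<bar> \<ge> 1") auto
  qed
qed

instantiation c0 :: real_vector
begin

definition zero_c0 :: c0 where "zero_c0 = Abs_c0 (\<lambda>_. 0)"
definition plus_c0 :: "c0 \<Rightarrow> c0 \<Rightarrow> c0" where "plus_c0 x y = Abs_c0 (\<lambda>i. coord x i + coord y i)"
definition uminus_c0 :: "c0 \<Rightarrow> c0" where "uminus_c0 x = Abs_c0 (\<lambda>i. - coord x i)"
definition minus_c0 :: "c0 \<Rightarrow> c0 \<Rightarrow> c0" where "minus_c0 x y = Abs_c0 (\<lambda>i. coord x i - coord y i)"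
definition scaleR_c0 :: "real \<Rightarrow> c0 \<Rightarrow> c0" where "scaleR_c0 r x = Abs_c0 (\<lambda>i. r * coord x i)"

lemma coord_zero [simp]: "coord 0 i = 0"
  unfolding zero_c0_def by (subst Abs_c0_inverse) auto

lemma coord_plus [simp]: "coord (x + y) i = coord x i + coord y i"
proof -
  have "finite {i \<in> idx. \<bar>coord x i + coord y i\<bar> \<ge> e}" if "e > 0" for e
  proof (rule finite_subset)
    show "{i \<in> idx. \<bar>coord x i + coord y i\<bar> \<ge> e}
        \<subseteq> {i \<in> idx. \<bar>coord x i\<bar> \<ge> e/2} \<union> {i \<in> idx. \<bar>coord y i\<bar> \<ge> e/2}"
      by auto
    show "finite ({i \<in> idx. \<bar>coord x i\<bar> \<ge> e/2} \<union> {i \<in> idx. \<bar>coord y i\<bar> \<ge> e/2})"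
      using coord_finite[of "e/2"] that by auto
  qed
  then show ?thesis
    unfolding plus_c0_def by (subst Abs_c0_inverse) (auto simp: coord_outside)
qed

lemma coord_scaleR [simp]: "coord (r *\<^sub>R x) i = r * coord x i"
proof -
  have "finite {i \<in> idx. \<bar>r * coord x i\<bar> \<ge> e}" if "e > 0" for e
  proof (cases "r = 0")
    case False
    then have "{i \<in> idx. \<bar>r * coord x i\<bar> \<ge> e} = {i \<in> idx. \<bar>coord x i\<bar> \<ge> e / \<bar>r\<bar>}"
      by (auto simp: abs_mult field_simps)
    then show ?thesis
      using coord_finite[of "e / \<bar>r\<bar>" x] that False by simp
  qed (use that in auto)
  then show ?thesis
    unfolding scaleR_c0_def by (subst Abs_c0_inverse) (auto simp: coord_outside)
qed

lemma coord_uminus [simp]: "coord (- x) i = - coord x i"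
  unfolding uminus_c0_def
  by (subst Abs_c0_inverse) (use coord_finite[of _ x] in \<open>auto simp: coord_outside\<close>)

lemma coord_minus [simp]: "coord (x - y) i = coord x i - coord y i"
proof -
  have "x - y = x + (- y)"
    by (simp add: minus_c0_def plus_c0_def)
  then show ?thesis by simp
qed

instance
  by standard (auto intro!: c0_eqI simp: algebra_simps)

end

instantiation c0 :: real_normed_vector
begin

definition norm_c0 :: "c0 \<Rightarrow> real" where "norm_c0 x = (SUP i\<in>idx. \<bar>coord x i\<bar>)"
definition dist_c0 :: "c0 \<Rightarrow> c0 \<Rightarrow> real" where "dist_c0 x y = norm (x - y)"
definition sgn_c0 :: "c0 \<Rightarrow> c0" where "sgn_c0 x = x /\<^sub>R norm x"
definition [code del]:
  "(uniformity :: (c0 \<times> c0) filter) = (INF e\<in>{0<..}. principal {(x, y). dist x y < e})"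
definition open_c0 :: "c0 set \<Rightarrow> bool" where [code del]:
  "open_c0 U \<longleftrightarrow> (\<forall>x\<in>U. eventually (\<lambda>(x', y). x' = x \<longrightarrow> y \<in> U) uniformity)"

lemma coord_le_norm: "\<bar>coord x i\<bar> \<le> norm x"
proof (cases "i \<in> idx")
  case True
  then show ?thesis unfolding norm_c0_def by (intro cSUP_upper coord_bdd)
next
  case False
  have "\<bar>coord x (0, 1)\<bar> \<le> norm x"
    unfolding norm_c0_def by (intro cSUP_upper coord_bdd) (auto simp: idx_def)
  then show ?thesis using False by (simp add: coord_outside)
qed

lemma norm_c0_le: "(\<And>i. i \<in> idx \<Longrightarrow> \<bar>coord x i\<bar> \<le> M) \<Longrightarrow> norm x \<le> M"
  unfolding norm_c0_def using idx_nonempty by (intro cSUP_least) auto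

instance
proof
  fix x y :: c0 and r :: real
  show "(norm x = 0) = (x = 0)"
  proof
    assume "norm x = 0"
    then show "x = 0" using coord_le_norm[of x] by (intro c0_eqI) simp
  next
    assume "x = 0"
    then show "norm x = 0" using idx_nonempty by (simp add: norm_c0_def)
  qed
  show "norm (x + y) \<le> norm x + norm y"
    by (rule norm_c0_le) (use coord_le_norm[of x] coord_le_norm[of y] abs_triangle_ineq in
        \<open>fastforce intro: order_trans add_mono\<close>)
  show "norm (r *\<^sub>R x) = \<bar>r\<bar> * norm x"
  proof (cases "r = 0")
    case True
    then show ?thesis using idx_nonempty by (simp add: norm_c0_def)
  next
    case False
    show ?thesis
    proof (rule antisym)
      show "norm (r *\<^sub>R x) \<le> \<bar>r\<bar> * norm x"
        by (rule norm_c0_le) (simp add: abs_mult coord_le_norm mult_left_mono)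
      have "norm x \<le> norm (r *\<^sub>R x) / \<bar>r\<bar>"
      proof (rule norm_c0_le)
        fix i
        show "\<bar>coord x i\<bar> \<le> norm (r *\<^sub>R x) / \<bar>r\<bar>"
          using coord_le_norm[of "r *\<^sub>R x" i] False by (simp add: abs_mult field_simps)
      qed
      then show "\<bar>r\<bar> * norm x \<le> norm (r *\<^sub>R x)"
        using False by (simp add: field_simps)
    qed
  qed
qed (rule dist_c0_def sgn_c0_def uniformity_c0_def open_c0_def)+

end

instance c0 :: banach
proof
  fix X :: "nat \<Rightarrow> c0"
  assume C: "Cauchy X"
  have "Cauchy (\<lambda>n. coord (X n) i)" for i
  proof (rule metric_CauchyI)
    fix e :: real assume "e > 0"
    then obtain N where N: "\<And>m n. m \<ge> N \<Longrightarrow> n \<ge> N \<Longrightarrow> dist (X m) (X n) < e"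
      using C by (meson metric_CauchyD)
    have "dist (coord (X m) i) (coord (X n) i) < e" if "m \<ge> N" "n \<ge> N" for m n
      using N[OF that] coord_le_norm[of "X m - X n" i] by (simp add: dist_norm)
    then show "\<exists>M. \<forall>m\<ge>M. \<forall>n\<ge>M. dist (coord (X m) i) (coord (X n) i) < e" by blast
  qed
  then have "\<forall>i. \<exists>l. (\<lambda>n. coord (X n) i) \<longlonglongrightarrow> l"
    using convergent_def real_Cauchy_convergent by blast
  then obtain L where L: "\<And>i. (\<lambda>n. coord (X n) i) \<longlonglongrightarrow> L i" by metis
  have unif: "\<exists>N. \<forall>n\<ge>N. \<forall>i. \<bar>coord (X n) i - L i\<bar> \<le> e" if "e > 0" for e
  proof -
    obtain N where N: "\<And>m n. m \<ge> N \<Longrightarrow> n \<ge> N \<Longrightarrow> dist (X m) (X n) < e"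
      using C \<open>e > 0\<close> by (meson metric_CauchyD)
    have "\<bar>coord (X n) i - L i\<bar> \<le> e" if "n \<ge> N" for n i
    proof (rule tendsto_upperbound)
      show "(\<lambda>m. \<bar>coord (X n) i - coord (X m) i\<bar>) \<longlonglongrightarrow> \<bar>coord (X n) i - L i\<bar>"
        by (intro tendsto_intros L)
      show "\<forall>\<^sub>F m in sequentially. \<bar>coord (X n) i - coord (X m) i\<bar> \<le> e"
      proof (rule eventually_sequentiallyI)
        fix m assume "m \<ge> N"
        then show "\<bar>coord (X n) i - coord (X m) i\<bar> \<le> e"
          using N[OF that] coord_le_norm[of "X n - X m" i] by (fastforce simp: dist_norm)
      qed
    qed simp
    then show ?thesis by blast
  qed
  have "finite {i \<in> idx. \<bar>L i\<bar> \<ge> e}" if "e > 0" for e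
  proof -
    obtain N where N: "\<And>i. \<bar>coord (X N) i - L i\<bar> \<le> e/2"
      using unif[OF half_gt_zero[OF \<open>e > 0\<close>]] by blast
    have "{i \<in> idx. \<bar>L i\<bar> \<ge> e} \<subseteq> {i \<in> idx. \<bar>coord (X N) i\<bar> \<ge> e/2}"
    proof safe
      fix a b assume "\<bar>L (a, b)\<bar> \<ge> e"
      then show "\<bar>coord (X N) (a, b)\<bar> \<ge> e/2" using N[of "(a, b)"] by linarith
    qed
    then show ?thesis
      using coord_finite[of "e/2" "X N"] that finite_subset by auto
  qed
  moreover have "L i = 0" if "i \<notin> idx" for i
    using L[of i] that by (simp add: coord_outside LIMSEQ_const_iff)
  ultimately have coordL: "coord (Abs_c0 L) = L"
    by (intro Abs_c0_inverse) auto
  have "X \<longlonglongrightarrow> Abs_c0 L"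
  proof (rule metric_LIMSEQ_I)
    fix e :: real assume "e > 0"
    then obtain N where N: "\<And>n i. n \<ge> N \<Longrightarrow> \<bar>coord (X n) i - L i\<bar> \<le> e/2"
      using unif[of "e/2"] by auto
    have "dist (X n) (Abs_c0 L) < e" if "n \<ge> N" for n
    proof -
      have "norm (X n - Abs_c0 L) \<le> e/2"
        by (rule norm_c0_le) (use N[OF that] in \<open>simp only: coordL coord_minus\<close>)
      then show ?thesis using \<open>e > 0\<close> by (simp add: dist_norm)
    qed
    then show "\<exists>N. \<forall>n\<ge>N. dist (X n) (Abs_c0 L) < e" by blast
  qed
  then show "convergent X" by (auto simp: convergent_def)
qed


section \<open>Summable arrays as the dual\<close>

definition l1 :: "(nat \<times> nat \<Rightarrow> real) set" where
  "l1 = {p. (\<forall>i. i \<notin> idx \<longrightarrow> p i = 0) \<and> (\<lambda>i. \<bar>p i\<bar>) summable_on idx}"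

definition l1_functional :: "(nat \<times> nat \<Rightarrow> real) \<Rightarrow> c0 \<Rightarrow>\<^sub>L real" where
  "l1_functional p = Blinfun (\<lambda>x. \<Sum>\<^sub>\<infinity>i\<in>idx. coord x i * p i)"

lemma pairing_abs_summable:
  assumes "p \<in> l1"
  shows "(\<lambda>i. \<bar>coord x i * p i\<bar>) summable_on idx"
proof (rule summable_on_comparison_test)
  show "(\<lambda>i. norm x * \<bar>p i\<bar>) summable_on idx"
    using assms by (intro summable_on_cmult_right) (simp add: l1_def)
qed (auto simp: abs_mult coord_le_norm mult_right_mono)

lemma pairing_summable: "p \<in> l1 \<Longrightarrow> (\<lambda>i. coord x i * p i) summable_on idx"
  using pairing_abs_summable[of p x] abs_summable_summable[of "\<lambda>i. coord x i * p i" idx] by simp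

lemma l1_functional_apply:
  assumes "p \<in> l1"
  shows "blinfun_apply (l1_functional p) x = (\<Sum>\<^sub>\<infinity>i\<in>idx. coord x i * p i)"
proof -
  have "bounded_linear (\<lambda>x. \<Sum>\<^sub>\<infinity>i\<in>idx. coord x i * p i)"
  proof (rule bounded_linear_intro[where K = "\<Sum>\<^sub>\<infinity>i\<in>idx. \<bar>p i\<bar>"])
    fix x y :: c0 and r :: real
    show "(\<Sum>\<^sub>\<infinity>i\<in>idx. coord (x + y) i * p i)
        = (\<Sum>\<^sub>\<infinity>i\<in>idx. coord x i * p i) + (\<Sum>\<^sub>\<infinity>i\<in>idx. coord y i * p i)"
      by (simp add: distrib_right infsum_add pairing_summable assms)
    show "(\<Sum>\<^sub>\<infinity>i\<in>idx. coord (r *\<^sub>R x) i * p i) = r *\<^sub>R (\<Sum>\<^sub>\<infinity>i\<in>idx. coord x i * p i)"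
      by (simp add: mult.assoc infsum_cmult_right')
    have "norm (\<Sum>\<^sub>\<infinity>i\<in>idx. coord x i * p i) \<le> (\<Sum>\<^sub>\<infinity>i\<in>idx. \<bar>coord x i * p i\<bar>)"
      using norm_infsum_bound[of "\<lambda>i. coord x i * p i" idx] pairing_abs_summable[OF assms] by simp
    also have "\<dots> \<le> (\<Sum>\<^sub>\<infinity>i\<in>idx. norm x * \<bar>p i\<bar>)"
      using assms pairing_abs_summable[OF assms]
      by (intro infsum_mono summable_on_cmult_right)
         (auto simp: l1_def abs_mult coord_le_norm mult_right_mono)
    also have "\<dots> = norm x * (\<Sum>\<^sub>\<infinity>i\<in>idx. \<bar>p i\<bar>)"
      by (rule infsum_cmult_right')
    finally show "norm (\<Sum>\<^sub>\<infinity>i\<in>idx. coord x i * p i) \<le> norm x * (\<Sum>\<^sub>\<infinity>i\<in>idx. \<bar>p i\<bar>)" .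
  qed
  then show ?thesis
    by (simp add: l1_functional_def bounded_linear_Blinfun_apply)
qed

definition unit_c0 :: "nat \<times> nat \<Rightarrow> c0" where
  "unit_c0 i = Abs_c0 (\<lambda>k. if k = i \<and> i \<in> idx then 1 else 0)"

lemma coord_unit: "coord (unit_c0 i) k = (if k = i \<and> i \<in> idx then 1 else 0)"
proof -
  have "finite {k \<in> idx. \<bar>if k = i \<and> i \<in> idx then 1 else 0 :: real\<bar> \<ge> e}" if "e > 0" for e
    by (rule finite_subset[of _ "{i}"]) (use that in \<open>auto split: if_splits\<close>)
  then show ?thesis
    unfolding unit_c0_def by (subst Abs_c0_inverse) auto
qed

lemma coord_sum: "coord (\<Sum>i\<in>F. f i) k = (\<Sum>i\<in>F. coord (f i) k)"
  by (induction F rule: infinite_finite_induct) auto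

lemma coord_sum_unit:
  assumes "finite F" "F \<subseteq> idx"
  shows "coord (\<Sum>i\<in>F. f i *\<^sub>R unit_c0 i) k = (if k \<in> F then f k else 0)"
proof -
  have "coord (\<Sum>i\<in>F. f i *\<^sub>R unit_c0 i) k = (\<Sum>i\<in>F. if i = k then f k else 0)"
    unfolding coord_sum using assms(2) by (intro sum.cong) (auto simp: coord_unit)
  then show ?thesis using assms(1) by simp
qed

text \<open>Every bounded functional on \<open>c0\<close> comes from exactly one element of \<open>l1\<close>.\<close>

theorem l1_functional_bij: "bij_betw l1_functional l1 UNIV"
proof (rule bij_betw_imageI)
  have unit: "blinfun_apply (l1_functional p) (unit_c0 i) = p i" if "p \<in> l1" "i \<in> idx" for p i
  proof -
    have "blinfun_apply (l1_functional p) (unit_c0 i) = (\<Sum>\<^sub>\<infinity>k\<in>idx. coord (unit_c0 i) k * p k)"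
      by (rule l1_functional_apply[OF that(1)])
    also have "\<dots> = (\<Sum>\<^sub>\<infinity>k\<in>{i}. p i)"
      by (rule infsum_cong_neutral) (use that in \<open>auto simp: coord_unit\<close>)
    finally show ?thesis by simp
  qed
  show "inj_on l1_functional l1"
  proof (rule inj_onI, rule ext)
    fix p q i assume p: "p \<in> l1" and q: "q \<in> l1" and eq: "l1_functional p = l1_functional q"
    show "p i = q i"
    proof (cases "i \<in> idx")
      case True
      then show ?thesis using unit[OF p True] unit[OF q True] eq by simp
    next
      case False
      then show ?thesis using p q unfolding l1_def by (metis (mono_tags, lifting) mem_Collect_eq)
    qed
  qed
  show "l1_functional ` l1 = UNIV"
  proof (intro set_eqI iffI UNIV_I)
    fix \<phi> :: "c0 \<Rightarrow>\<^sub>L real"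
    define p where "p i = blinfun_apply \<phi> (unit_c0 i)" for i
    have app: "blinfun_apply \<phi> (\<Sum>i\<in>F. f i *\<^sub>R unit_c0 i) = (\<Sum>i\<in>F. f i * p i)" for f F
      by (simp add: blinfun.sum_right blinfun.scaleR_right p_def)
    have "unit_c0 i = 0" if "i \<notin> idx" for i
      using that by (intro c0_eqI) (simp add: coord_unit)
    then have out: "p i = 0" if "i \<notin> idx" for i
      using that by (simp add: p_def)
    have "(\<lambda>i. \<bar>p i\<bar>) summable_on idx"
    proof (rule nonneg_bdd_above_summable_on)
      show "bdd_above (sum (\<lambda>i. \<bar>p i\<bar>) ` {F. F \<subseteq> idx \<and> finite F})"
      proof (rule bdd_aboveI2)
        fix F assume "F \<in> {F. F \<subseteq> idx \<and> finite F}"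
        then have F: "F \<subseteq> idx" "finite F" by auto
        let ?x = "\<Sum>i\<in>F. sgn (p i) *\<^sub>R unit_c0 i"
        have "norm ?x \<le> 1"
          by (rule norm_c0_le) (simp add: coord_sum_unit F abs_sgn_eq)
        have "(\<Sum>i\<in>F. \<bar>p i\<bar>) = blinfun_apply \<phi> ?x"
          unfolding app by (intro sum.cong) (auto simp: abs_sgn mult.commute)
        also have "\<dots> \<le> norm \<phi> * norm ?x"
          using norm_blinfun[of \<phi> ?x] by simp
        also have "\<dots> \<le> norm \<phi> * 1"
          using \<open>norm ?x \<le> 1\<close> by (intro mult_left_mono) auto
        finally show "(\<Sum>i\<in>F. \<bar>p i\<bar>) \<le> norm \<phi>" by simp
      qed
    qed simp
    with out have p: "p \<in> l1" by (simp add: l1_def)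
    have "l1_functional p = \<phi>"
    proof (rule blinfun_eqI)
      fix x
      let ?d = "l1_functional p - \<phi>"
      have "\<bar>blinfun_apply ?d x\<bar> \<le> e" if "e > 0" for e
      proof -
        define \<delta> where "\<delta> = e / (norm ?d + 1)"
        have "norm ?d + 1 > 0" by (simp add: add_nonneg_pos)
        then have "\<delta> > 0" using that by (simp add: \<delta>_def)
        define F where "F = {i \<in> idx. \<bar>coord x i\<bar> \<ge> \<delta>}"
        have F: "finite F" "F \<subseteq> idx"
          using coord_finite[OF \<open>\<delta> > 0\<close>] by (auto simp: F_def)
        let ?y = "\<Sum>i\<in>F. coord x i *\<^sub>R unit_c0 i"
        have "blinfun_apply ?d ?y = (\<Sum>i\<in>F. coord x i * blinfun_apply ?d (unit_c0 i))"
          by (simp only: blinfun.sum_right blinfun.scaleR_right real_scaleR_def)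
        also have "\<dots> = 0"
          using F(2) unit[OF p] by (intro sum.neutral) (auto simp: blinfun.diff_left p_def)
        finally have "blinfun_apply ?d x = blinfun_apply ?d (x - ?y)"
          by (simp add: blinfun.diff_right)
        moreover have "norm (x - ?y) \<le> \<delta>"
          by (rule norm_c0_le) (use \<open>\<delta> > 0\<close> in \<open>auto simp: coord_sum_unit F\<close>, auto simp: F_def)
        ultimately have "\<bar>blinfun_apply ?d x\<bar> \<le> norm ?d * \<delta>"
          using norm_blinfun[of ?d "x - ?y"] mult_left_mono[of "norm (x - ?y)" \<delta> "norm ?d"] by simp
        also have "\<dots> \<le> e"
          using \<open>norm ?d + 1 > 0\<close> that by (simp add: \<delta>_def field_simps)
        finally show ?thesis .
      qed
      then have "\<bar>blinfun_apply ?d x\<bar> \<le> 0" by (rule field_le_epsilon[where y = 0, simplified])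
      then show "blinfun_apply (l1_functional p) x = blinfun_apply \<phi> x"
        by (simp add: blinfun.diff_left)
    qed
    then show "\<phi> \<in> l1_functional ` l1" using p by blast
  qed
qed


section \<open>The operator\<close>

definition row_entry :: "c0 \<Rightarrow> nat \<Rightarrow> nat \<Rightarrow> real" where
  "row_entry x b j = 4 ^ b * (coord x (b, j) + 2 * (\<Sum>k = 1..<j. (-1) ^ (j - k) * coord x (b, k)))
     + 2 * (-1) ^ (j - 1) / \<bar>coord x (0, 1)\<bar> ^ b"

definition D :: "c0 set" where
  "D = {x. \<bar>coord x (0, 1)\<bar> > 1 \<and>
     (\<Sum>\<^sub>\<infinity>b\<in>{1..}. \<Sum>\<^sub>\<infinity>j\<in>{1..}. ennreal \<bar>row_entry x b j\<bar>) < \<infinity>}"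

definition A_val :: "c0 \<Rightarrow> nat \<times> nat \<Rightarrow> real" where
  "A_val x = (\<lambda>(b, j).
     if j = 0 then 0
     else if b = 0 then (if j = 1 then coord x (0, 1) - sgn (coord x (0, 1)) else 0)
     else row_entry x b j)"

definition A :: "c0 \<Rightarrow> (c0 \<Rightarrow>\<^sub>L real) set" where
  "A x = (if x \<in> D then {l1_functional (A_val x)} else {})"

lemma op_dom_A: "op_dom A = D"
  by (auto simp: op_dom_def A_def)

lemma A_val_l1:
  assumes "x \<in> D"
  shows "A_val x \<in> l1"
proof -
  define S where "S = (\<Sum>\<^sub>\<infinity>b\<in>{1..}. \<Sum>\<^sub>\<infinity>j\<in>{1..}. ennreal \<bar>row_entry x b j\<bar>)"
  have sum_le: "sum f B \<le> infsum f C" if "finite B" "B \<subseteq> C" for f :: "nat \<Rightarrow> ennreal" and B C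
  proof -
    have "infsum f B \<le> infsum f C"
      by (rule infsum_mono_neutral) (use that in \<open>auto intro: nonneg_summable_on_complete\<close>)
    then show ?thesis using that(1) by simp
  qed
  have S: "S < \<infinity>" using assms by (simp add: D_def S_def)
  have rows: "(\<lambda>(b, j). \<bar>row_entry x b j\<bar>) summable_on {1..} \<times> {1..}"
  proof (rule nonneg_bdd_above_summable_on)
    show "bdd_above (sum (\<lambda>(b, j). \<bar>row_entry x b j\<bar>) ` {F. F \<subseteq> {1..} \<times> {1..} \<and> finite F})"
    proof (rule bdd_aboveI2)
      fix F :: "(nat \<times> nat) set" assume "F \<in> {F. F \<subseteq> {1..} \<times> {1..} \<and> finite F}"
      then have F: "F \<subseteq> {1..} \<times> {1..}" "finite F" by auto
      have "ennreal (sum (\<lambda>(b, j). \<bar>row_entry x b j\<bar>) F)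
          \<le> ennreal (\<Sum>(b, j)\<in>fst ` F \<times> snd ` F. \<bar>row_entry x b j\<bar>)"
        using F(2) by (intro ennreal_leI sum_mono2) (auto intro: rev_image_eqI)
      also have "\<dots> = (\<Sum>b\<in>fst ` F. \<Sum>j\<in>snd ` F. ennreal \<bar>row_entry x b j\<bar>)"
        by (simp add: sum.cartesian_product[symmetric] sum_ennreal sum_nonneg)
      also have "\<dots> \<le> (\<Sum>b\<in>fst ` F. \<Sum>\<^sub>\<infinity>j\<in>{1..}. ennreal \<bar>row_entry x b j\<bar>)"
      proof (rule sum_mono)
        fix b
        have "snd ` F \<subseteq> {1..}" using F by auto
        then show "(\<Sum>j\<in>snd ` F. ennreal \<bar>row_entry x b j\<bar>) \<le> (\<Sum>\<^sub>\<infinity>j\<in>{1..}. ennreal \<bar>row_entry x b j\<bar>)"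
          using F(2) by (intro sum_le) simp_all
      qed
      also have "\<dots> \<le> S"
        unfolding S_def by (intro sum_le) (use F in auto)
      finally have "ennreal (sum (\<lambda>(b, j). \<bar>row_entry x b j\<bar>) F) \<le> S" .
      then show "sum (\<lambda>(b, j). \<bar>row_entry x b j\<bar>) F \<le> enn2real S"
        using S by (metis enn2real_nonneg ennreal_enn2real ennreal_le_iff infinity_ennreal_def)
    qed
  qed auto
  have "(\<lambda>i. \<bar>A_val x i\<bar>) summable_on {1..} \<times> {1..}"
    using rows by (rule summable_on_cong[THEN iffD1, rotated]) (auto simp: A_val_def)
  moreover have "(\<lambda>i. \<bar>A_val x i\<bar>) summable_on {(0, 1)}"
    by simp
  ultimately have "(\<lambda>i. \<bar>A_val x i\<bar>) summable_on ({1..} \<times> {1..}) \<union> {(0, 1)}"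
    by (intro summable_on_Un_disjoint) auto
  then have "(\<lambda>i. \<bar>A_val x i\<bar>) summable_on idx"
    by (rule summable_on_cong_neutral[THEN iffD1, rotated -1])
       (auto simp: A_val_def idx_def split: if_splits)
  then show ?thesis by (auto simp: l1_def A_val_def idx_def)
qed

end

theory Submission
  imports Defs "HOL-Real_Asymp.Real_Asymp"
begin

text \<open>
  The idea is to describe a pair \<open>(x, p)\<close> of the graph in each row \<open>b \<ge> 1\<close> by the potential
  \<open>G j = (p (b, j) - 4^b * x (b, j)) / 2\<close>. The equations defining the operator say exactly that
  \<open>p (b, j) = G j - G (j + 1)\<close> and \<open>4^b * x (b, j) = -(G j + G (j + 1))\<close>, with the boundary value
  \<open>G 1 = 1 / |x (0, 1)|^b\<close>. Pairs satisfying the two row equations with an arbitrary \<open>G 1\<close>, where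
  \<open>p\<close> is summable and vanishes in row \<open>0\<close> after its first entry, are called \<^emph>\<open>linked\<close>; they form a
  linear space. Since \<open>G\<close> tends to \<open>0\<close>, two sums telescope
  (\<open>linked_row_sums\<close>): the row sum of \<open>p\<close> is \<open>G 1\<close>, and the pairing of \<open>x\<close> and \<open>p\<close> over the row is
  \<open>-G 1^2 / 4^b\<close>. So each row acts as a skew operator with a negative boundary term.

  Monotonicity. The pairing of the difference of two graph pairs with first coordinates \<open>s\<close> and
  \<open>t\<close> is \<open>(s - t) ((s - sgn s) - (t - sgn t))\<close> minus the sum over \<open>b \<ge> 1\<close> of
  \<open>(|s|^(-b) - |t|^(-b))^2 / 4^b\<close>. As \<open>|s|, |t| > 1\<close>, the first term is at least \<open>(|s| - |t|)^2\<close>, while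
  the sum is at most \<open>(|s| - |t|)^2\<close> times the sum of \<open>b^2 / 4^b\<close>, which is \<open>20/27 < 1\<close>.

  Maximality. Moving a graph pair along a linked pair with zero boundary values and zero entries at
  \<open>(0, 1)\<close> stays in the graph and is neutral for the pairing, so a pair \<open>(z, p)\<close> monotonically
  related to the graph satisfies a linear equation for each such direction; together these say that
  \<open>(z, p)\<close> is linked (\<open>related_imp_linked\<close>). What remains is a scalar inequality in \<open>t\<close>. If
  \<open>|z (0, 1)| > 1\<close> it puts \<open>(z, p)\<close> into the graph. If \<open>|z (0, 1)| \<le> 1\<close> it forces every
  boundary value to be \<open>1\<close>; but these are the row sums of the summable array \<open>p\<close>, which is absurd. This is how the
  gap \<open>[-1, 1]\<close> in the domain resists any monotone extension.

  Failure of type (FPV). On the half space \<open>x (0, 1) > -1\<close> only the branch \<open>x (0, 1) > 1\<close> of the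
  domain is visible, and there a linked pair with \<open>z (0, 1) = 0\<close> becomes monotonically related once \<open>p (0, 1)\<close> is
  negative enough. The gap also separates the two branches of the closed domain.
\<close>

section \<open>Functionals given by summable arrays\<close>

lemma l1_scale: "p \<in> l1 \<Longrightarrow> (\<lambda>i. r * p i) \<in> l1"
  by (auto simp: l1_def abs_mult intro: summable_on_cmult_right)

lemma l1_add:
  assumes "p \<in> l1" "q \<in> l1"
  shows "(\<lambda>i. p i + q i) \<in> l1"
proof -
  have "(\<lambda>i. \<bar>p i + q i\<bar>) summable_on idx"
    by (rule summable_on_comparison_test[where f = "\<lambda>i. \<bar>p i\<bar> + \<bar>q i\<bar>"])
       (use assms in \<open>auto simp: l1_def intro: summable_on_add\<close>)
  then show ?thesis using assms by (simp add: l1_def)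
qed

lemma l1_diff: "p \<in> l1 \<Longrightarrow> q \<in> l1 \<Longrightarrow> (\<lambda>i. p i - q i) \<in> l1"
  using l1_add[OF _ l1_scale, of p q "-1"] by simp

lemma l1_functional_add_scale:
  assumes "p \<in> l1" "q \<in> l1"
  shows "l1_functional (\<lambda>i. p i + r * q i) = l1_functional p + r *\<^sub>R l1_functional q"
proof (rule blinfun_eqI)
  fix x
  have "(\<Sum>\<^sub>\<infinity>i\<in>idx. coord x i * (r * q i)) = r * (\<Sum>\<^sub>\<infinity>i\<in>idx. coord x i * q i)"
    by (simp flip: infsum_cmult_right' add: mult.left_commute)
  then show "blinfun_apply (l1_functional (\<lambda>i. p i + r * q i)) x
      = blinfun_apply (l1_functional p + r *\<^sub>R l1_functional q) x"
    using pairing_summable[OF assms(1), of x] pairing_summable[OF l1_scale[OF assms(2), of r], of x]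
    by (simp add: blinfun.add_left blinfun.scaleR_left l1_functional_apply assms l1_add l1_scale
        distrib_left infsum_add)
qed

lemma l1_functional_diff:
  "p \<in> l1 \<Longrightarrow> q \<in> l1 \<Longrightarrow>
    l1_functional (\<lambda>i. p i - q i) = l1_functional p - l1_functional q"
  using l1_functional_add_scale[of p q "-1"] by simp

lemma l1_finite_support:
  assumes "finite F" "F \<subseteq> idx" "\<And>i. i \<notin> F \<Longrightarrow> p i = 0"
  shows "p \<in> l1" and "blinfun_apply (l1_functional p) x = (\<Sum>i\<in>F. coord x i * p i)"
proof -
  have "(\<lambda>i. \<bar>p i\<bar>) summable_on F" using assms(1) by simp
  then have "(\<lambda>i. \<bar>p i\<bar>) summable_on idx"
    by (rule summable_on_cong_neutral[THEN iffD1, rotated -1]) (use assms in auto)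
  then show p: "p \<in> l1" using assms by (auto simp: l1_def)
  have "(\<Sum>\<^sub>\<infinity>i\<in>idx. coord x i * p i) = (\<Sum>\<^sub>\<infinity>i\<in>F. coord x i * p i)"
    by (rule infsum_cong_neutral) (use assms in auto)
  then show "blinfun_apply (l1_functional p) x = (\<Sum>i\<in>F. coord x i * p i)"
    using assms(1) by (simp add: l1_functional_apply[OF p])
qed

lemma l1_functional_unit:
  assumes "p \<in> l1" "i \<in> idx"
  shows "blinfun_apply (l1_functional p) (unit_c0 i) = p i"
proof -
  have "(\<Sum>\<^sub>\<infinity>k\<in>idx. coord (unit_c0 i) k * p k) = (\<Sum>\<^sub>\<infinity>k\<in>{i}. p i)"
    by (rule infsum_cong_neutral) (use assms in \<open>auto simp: coord_unit\<close>)
  then show ?thesis by (simp add: l1_functional_apply[OF assms(1)])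
qed

section \<open>Rows of arrays\<close>

lemma has_sum_from_1_iff:
  fixes f :: "nat \<Rightarrow> real"
  shows "(f has_sum S) {1..} \<longleftrightarrow> ((\<lambda>n. f (Suc n)) has_sum S) UNIV"
proof -
  have "bij_betw Suc UNIV {1..}"
    by (rule bij_betwI[where g = "\<lambda>n. n - 1"]) auto
  from has_sum_reindex_bij_betw[OF this, of f S] show ?thesis by simp
qed

lemma row_tendsto_0:
  fixes f :: "nat \<times> nat \<Rightarrow> real"
  assumes "\<And>e. e > 0 \<Longrightarrow> finite {i \<in> idx. \<bar>f i\<bar> \<ge> e}"
  shows "(\<lambda>n. f (b, Suc n)) \<longlonglongrightarrow> 0"
proof (rule LIMSEQ_I)
  fix e :: real assume "e > 0"
  have "finite {n. \<bar>f (b, Suc n)\<bar> \<ge> e}"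
  proof (rule finite_imageD)
    show "finite ((\<lambda>n. (b, Suc n)) ` {n. \<bar>f (b, Suc n)\<bar> \<ge> e})"
      by (rule finite_subset[OF _ assms[OF \<open>e > 0\<close>]]) (auto simp: idx_def)
  qed (auto intro: inj_onI)
  then obtain N where "\<forall>n\<in>{n. \<bar>f (b, Suc n)\<bar> \<ge> e}. n < N"
    using finite_nat_set_iff_bounded by blast
  then have "\<forall>n\<ge>N. norm (f (b, Suc n) - 0) < e"
    by (metis diff_zero mem_Collect_eq not_le real_norm_def)
  then show "\<exists>N. \<forall>n\<ge>N. norm (f (b, Suc n) - 0) < e" by blast
qed

lemma summable_on_idx_row: "(\<lambda>i. f i) summable_on idx \<Longrightarrow> (\<lambda>j. f (b, j)) summable_on {1..}"
  for f :: "nat \<times> nat \<Rightarrow> real"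
  using summable_on_SigmaD1[of "\<lambda>b j. f (b, j)" UNIV "\<lambda>_. {1..}" b] by (simp add: idx_def)

section \<open>Linked pairs and their potentials\<close>

text \<open>Adding the defining equations of two consecutive entries of a row cancels the alternating sums;
  what is left is the recurrence below. In terms of the potential
  \<open>G j = (p (b, j) - 4^b * x (b, j)) / 2\<close> it reads \<open>p (b, j) = G j - G (j + 1)\<close>.\<close>

definition linked :: "c0 \<Rightarrow> (nat \<times> nat \<Rightarrow> real) \<Rightarrow> bool" where
  "linked x p \<longleftrightarrow> p \<in> l1 \<and> (\<forall>j\<ge>2. p (0, j) = 0) \<and>
     (\<forall>b\<ge>1. \<forall>j\<ge>1. p (b, j) + p (b, Suc j) = 4 ^ b * (coord x (b, Suc j) - coord x (b, j)))"

text \<open>The potential at the first entry, which is the one degree of freedom that the recurrence leaves to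
  \<open>p\<close> in row \<open>b\<close> when \<open>x\<close> is given.\<close>

definition boundary :: "c0 \<Rightarrow> (nat \<times> nat \<Rightarrow> real) \<Rightarrow> nat \<Rightarrow> real" where
  "boundary x p b = (p (b, 1) - 4 ^ b * coord x (b, 1)) / 2"

lemma linked_add_scale:
  assumes "linked x p" "linked y q"
  shows "linked (x + r *\<^sub>R y) (\<lambda>i. p i + r * q i)"
  unfolding linked_def
proof (intro conjI allI impI)
  show "(\<lambda>i. p i + r * q i) \<in> l1"
    using assms by (intro l1_add l1_scale) (simp_all add: linked_def)
  show "p (0, j) + r * q (0, j) = 0" if "j \<ge> 2" for j
    using assms that by (simp add: linked_def)
  show "p (b, j) + r * q (b, j) + (p (b, Suc j) + r * q (b, Suc j))
      = 4 ^ b * (coord (x + r *\<^sub>R y) (b, Suc j) - coord (x + r *\<^sub>R y) (b, j))"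
    if "b \<ge> 1" "j \<ge> 1" for b j
  proof -
    have "p (b, j) + p (b, Suc j) = 4 ^ b * (coord x (b, Suc j) - coord x (b, j))"
      "r * (q (b, j) + q (b, Suc j)) = r * (4 ^ b * (coord y (b, Suc j) - coord y (b, j)))"
      using assms that by (simp_all add: linked_def)
    then show ?thesis by (simp add: algebra_simps)
  qed
qed

lemma boundary_add_scale:
  "boundary (x + r *\<^sub>R y) (\<lambda>i. p i + r * q i) b = boundary x p b + r * boundary y q b"
  by (simp add: boundary_def field_simps)

lemma linked_diff: "linked x p \<Longrightarrow> linked y q \<Longrightarrow> linked (x - y) (\<lambda>i. p i - q i)"
  using linked_add_scale[of x p y q "-1"] by simp

lemma boundary_diff: "boundary (x - y) (\<lambda>i. p i - q i) b = boundary x p b - boundary y q b"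
  using boundary_add_scale[of x "-1" y p q b] by simp

text \<open>Both sums telescope: \<open>r j = G j - G (j + 1)\<close> and \<open>4^b * w j = -(G j + G (j + 1))\<close> give
  \<open>4^b * w j * r j = G (j + 1)^2 - G j^2\<close>, and \<open>G\<close> tends to \<open>0\<close> because \<open>w\<close> is a null array and \<open>r\<close> is
  summable.\<close>

lemma linked_row_sums:
  assumes "linked w r" "b \<ge> 1"
  shows "((\<lambda>j. r (b, j)) has_sum boundary w r b) {1..}"
    and "((\<lambda>j. coord w (b, j) * r (b, j)) has_sum - (boundary w r b)\<^sup>2 / 4 ^ b) {1..}"
proof -
  have r: "r \<in> l1" and step: "\<And>j. j \<ge> 1 \<Longrightarrow>
      r (b, j) + r (b, Suc j) = 4 ^ b * (coord w (b, Suc j) - coord w (b, j))"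
    using assms by (auto simp: linked_def)
  have r_sum: "r summable_on idx"
    using r abs_summable_summable[of r idx] by (simp add: l1_def)
  \<comment> \<open>The potential, shifted so that index \<open>0\<close> is the first entry of the row.\<close>
  define G where "G n = (r (b, Suc n) - 4 ^ b * coord w (b, Suc n)) / 2" for n
  have G0: "G 0 = boundary w r b" by (simp add: G_def boundary_def)
  have "(\<lambda>n. r (b, Suc n)) \<longlonglongrightarrow> 0"
  proof -
    have "(\<lambda>n. r (b, Suc n)) summable_on UNIV"
      using summable_on_idx_row[OF r_sum, of b] has_sum_from_1_iff[of "\<lambda>j. r (b, j)"]
      by (auto simp: summable_on_def)
    then show ?thesis by (intro summable_LIMSEQ_zero summable_on_imp_summable)
  qed
  moreover have "(\<lambda>n. coord w (b, Suc n)) \<longlonglongrightarrow> 0"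
    by (rule row_tendsto_0) (rule coord_finite)
  ultimately have G: "G \<longlonglongrightarrow> 0"
    unfolding G_def by (auto intro!: tendsto_eq_intros)
  have r_eq: "r (b, Suc n) = G n - G (Suc n)" for n
    using step[of "Suc n"] by (simp add: G_def field_simps)
  have w_eq: "coord w (b, Suc n) = - (G n + G (Suc n)) / 4 ^ b" for n
    using step[of "Suc n"] by (simp add: G_def field_simps)
  have "(\<lambda>n. r (b, Suc n)) sums (G 0 - 0)"
    unfolding r_eq by (rule telescope_sums'[OF G])
  moreover obtain S where S: "((\<lambda>j. r (b, j)) has_sum S) {1..}"
    using summable_on_idx_row[OF r_sum, of b] by (auto simp: summable_on_def)
  moreover have "(\<lambda>n. r (b, Suc n)) sums S"
    using S has_sum_from_1_iff has_sum_imp_sums by blast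
  ultimately show "((\<lambda>j. r (b, j)) has_sum boundary w r b) {1..}"
    using sums_unique2 G0 by fastforce
  have "(\<lambda>n. (G n)\<^sup>2 / 4 ^ b) \<longlonglongrightarrow> 0"
    using G by (auto intro!: tendsto_eq_intros)
  then have "(\<lambda>n. (G (Suc n))\<^sup>2 / 4 ^ b - (G n)\<^sup>2 / 4 ^ b) sums (0 - (G 0)\<^sup>2 / 4 ^ b)"
    by (rule telescope_sums)
  also have "(\<lambda>n. (G (Suc n))\<^sup>2 / 4 ^ b - (G n)\<^sup>2 / 4 ^ b)
      = (\<lambda>n. coord w (b, Suc n) * r (b, Suc n))"
    unfolding r_eq w_eq by (rule ext) (simp add: field_simps power2_eq_square)
  finally have sums: "(\<lambda>n. coord w (b, Suc n) * r (b, Suc n)) sums (- (boundary w r b)\<^sup>2 / 4 ^ b)"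
    by (simp add: G0)
  obtain T where T: "((\<lambda>j. coord w (b, j) * r (b, j)) has_sum T) {1..}"
    using summable_on_idx_row[OF pairing_summable[OF r], of w b] by (auto simp: summable_on_def)
  then have "(\<lambda>n. coord w (b, Suc n) * r (b, Suc n)) sums T"
    using has_sum_from_1_iff[of "\<lambda>j. coord w (b, j) * r (b, j)"] has_sum_imp_sums by blast
  with sums T show "((\<lambda>j. coord w (b, j) * r (b, j)) has_sum - (boundary w r b)\<^sup>2 / 4 ^ b) {1..}"
    using sums_unique2 by metis
qed

text \<open>Summing the row pairings. The square sum is written as a series with an explicit value, so that
  both upper bounds for it (monotonicity) and lower bounds by one of its terms (maximality) turn into
  statements about the pairing.\<close>

lemma linked_pairing:
  assumes "linked w r"
  shows "((\<lambda>b. (boundary w r b)\<^sup>2 / 4 ^ b) has_sum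
    coord w (0, 1) * r (0, 1) - blinfun_apply (l1_functional r) w) {1..}"
proof -
  have r: "r \<in> l1" using assms by (simp add: linked_def)
  let ?S = "blinfun_apply (l1_functional r) w"
  define g where "g b = (if b = 0 then coord w (0, 1) * r (0, 1) else - (boundary w r b)\<^sup>2 / 4 ^ b)"
    for b
  have "((\<lambda>i. coord w i * r i) has_sum ?S) (UNIV \<times> {1..})"
    using has_sum_infsum[OF pairing_summable[OF r, of w]]
    by (simp only: l1_functional_apply[OF r] idx_def)
  moreover have "((\<lambda>j. coord w (b, j) * r (b, j)) has_sum g b) {1..}" for b
  proof (cases "b = 0")
    case True
    have "((\<lambda>j. coord w (0, j) * r (0, j)) has_sum coord w (0, 1) * r (0, 1)) {1}"
      using has_sum_finite[of "{1}" "\<lambda>j. coord w (0, j) * r (0, j)"] by simp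
    then have "((\<lambda>j. coord w (0, j) * r (0, j)) has_sum coord w (0, 1) * r (0, 1)) {1..}"
      by (rule has_sum_cong_neutral[THEN iffD1, rotated -1])
         (use assms in \<open>auto simp: linked_def\<close>)
    then show ?thesis using True by (simp add: g_def)
  next
    case False
    then show ?thesis using linked_row_sums(2)[OF assms, of b] by (simp add: g_def)
  qed
  ultimately have "(g has_sum ?S) UNIV"
    by (rule has_sum_SigmaD)
  moreover have "(g has_sum g 0) {0}"
    using has_sum_finite[of "{0}" g] by simp
  ultimately have "(g has_sum (?S - g 0)) (UNIV - {0})"
    by (rule has_sum_Diff) auto
  then have "((\<lambda>b. - g b) has_sum (g 0 - ?S)) (UNIV - {0})"
    using has_sum_uminusI by fastforce
  also have "UNIV - {0} = {1::nat..}" by auto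
  also have "((\<lambda>b. - g b) has_sum (g 0 - ?S)) {1..}
      \<longleftrightarrow> ((\<lambda>b. (boundary w r b)\<^sup>2 / 4 ^ b) has_sum (g 0 - ?S)) {1..}"
    by (rule has_sum_cong) (auto simp: g_def)
  finally show ?thesis by (simp add: g_def)
qed

text \<open>The boundary values are the row sums of a summable array. This is the obstruction that keeps
  points with \<open>|x (0, 1)| \<le> 1\<close> out of every monotone extension of the operator.\<close>

lemma linked_boundary_summable:
  assumes "linked x p"
  shows "boundary x p summable_on {1..}"
proof -
  have "p summable_on idx"
    using assms abs_summable_summable[of p idx] by (simp add: l1_def linked_def)
  then have "p summable_on {1..} \<times> {1..}"
    by (rule summable_on_subset_banach) (auto simp: idx_def)
  then obtain S where "(p has_sum S) ({1..} \<times> {1..})" by (auto simp: summable_on_def)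
  then have "(boundary x p has_sum S) {1..}"
    by (rule has_sum_SigmaD) (use linked_row_sums(1)[OF assms] in auto)
  then show ?thesis by (auto simp: summable_on_def)
qed


section \<open>The graph of the operator\<close>

text \<open>The graph in terms of arrays: the boundary value of each row is tied to the entry at \<open>(0, 1)\<close>,
  which is the only coupling between the rows.\<close>

definition graph_pair :: "c0 \<Rightarrow> (nat \<times> nat \<Rightarrow> real) \<Rightarrow> bool" where
  "graph_pair x p \<longleftrightarrow> linked x p \<and> \<bar>coord x (0, 1)\<bar> > 1 \<and>
     p (0, 1) = coord x (0, 1) - sgn (coord x (0, 1)) \<and>
     (\<forall>b\<ge>1. boundary x p b = 1 / \<bar>coord x (0, 1)\<bar> ^ b)"

lemma row_entry_Suc:
  assumes "j \<ge> 1"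
  shows "row_entry x b j + row_entry x b (Suc j)
    = 4 ^ b * (coord x (b, Suc j) - coord x (b, j))"
proof -
  have "(\<Sum>k = 1..<Suc j. (-1) ^ (Suc j - k) * coord x (b, k))
      = - coord x (b, j) - (\<Sum>k = 1..<j. (-1) ^ (j - k) * coord x (b, k))"
    using assms by (simp add: Suc_diff_le sum_negf[symmetric] cong: sum.cong_simp)
  moreover have "(-1::real) ^ (Suc j - 1) = - ((-1) ^ (j - 1))"
    using assms by (cases j) auto
  ultimately show ?thesis
    unfolding row_entry_def by (simp only:) (simp add: algebra_simps)
qed

lemma row_entry_1: "row_entry x b 1 = 4 ^ b * coord x (b, 1) + 2 / \<bar>coord x (0, 1)\<bar> ^ b"
  by (simp add: row_entry_def)

lemma graph_pair_A_val:
  assumes "x \<in> D"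
  shows "graph_pair x (A_val x)"
  using assms A_val_l1[OF assms] row_entry_1[of x] row_entry_Suc[of _ x]
  by (auto simp: graph_pair_def linked_def boundary_def A_val_def D_def)

text \<open>The domain is defined by a double series in \<open>ennreal\<close>; this bound leads from absolute
  summability over the index set back to it.\<close>

lemma ennreal_iterated_sum_finite:
  assumes "p \<in> l1"
  shows "(\<Sum>\<^sub>\<infinity>b\<in>{1..}. \<Sum>\<^sub>\<infinity>j\<in>{1..}. ennreal \<bar>p (b, j)\<bar>) < \<infinity>"
proof -
  have s: "(\<lambda>i. \<bar>p i\<bar>) summable_on UNIV \<times> {1..}"
    using assms by (simp add: l1_def idx_def)
  let ?row = "\<lambda>b. \<Sum>\<^sub>\<infinity>j\<in>{1..}. \<bar>p (b, j)\<bar>"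
  have row: "(\<lambda>j. \<bar>p (b, j)\<bar>) summable_on {1..}" for b
    using summable_on_idx_row[of "\<lambda>i. \<bar>p i\<bar>" b] s by (simp add: idx_def)
  have rows: "?row summable_on UNIV"
    using summable_on_SigmaD[OF s] row by simp
  have "(\<Sum>\<^sub>\<infinity>j\<in>{1..}. ennreal \<bar>p (b, j)\<bar>) \<le> ennreal (?row b)" for b
    by (rule infsum_le_finite_sums)
       (auto simp: sum_ennreal simp del: One_nat_def
         intro!: ennreal_leI finite_sum_le_infsum row nonneg_summable_on_complete)
  then have "(\<Sum>\<^sub>\<infinity>b\<in>{1..}. \<Sum>\<^sub>\<infinity>j\<in>{1..}. ennreal \<bar>p (b, j)\<bar>) \<le> (\<Sum>\<^sub>\<infinity>b\<in>{1..}. ennreal (?row b))"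
    by (intro infsum_mono nonneg_summable_on_complete) auto
  also have "\<dots> \<le> ennreal (infsum ?row UNIV)"
    by (rule infsum_le_finite_sums)
       (auto simp: sum_ennreal infsum_nonneg simp del: One_nat_def
         intro!: ennreal_leI finite_sum_le_infsum rows nonneg_summable_on_complete)
  also have "\<dots> < \<infinity>" by simp
  finally show ?thesis .
qed

text \<open>The first row entry is determined by the boundary value and the others follow by the recurrence,
  so \<open>p\<close> is the value of the operator, and its summability is membership of \<open>x\<close> in the domain.\<close>

lemma graph_pair_imp:
  assumes "graph_pair x p"
  shows "x \<in> D" and "A_val x = p"
proof -
  have link: "linked x p" and gt: "\<bar>coord x (0, 1)\<bar> > 1"
    and p01: "p (0, 1) = coord x (0, 1) - sgn (coord x (0, 1))"
    and bd: "\<And>b. b \<ge> 1 \<Longrightarrow> boundary x p b = 1 / \<bar>coord x (0, 1)\<bar> ^ b"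
    using assms by (auto simp: graph_pair_def)
  have rows: "row_entry x b j = p (b, j)" if "b \<ge> 1" "j \<ge> 1" for b j
    using that(2)
  proof (induction j rule: dec_induct)
    case base
    then show ?case
      using bd[OF that(1)] row_entry_1[of x b] by (simp add: boundary_def field_simps)
  next
    case (step j)
    then show ?case
      using row_entry_Suc[of j x b] link that(1) unfolding linked_def
      by (metis add_left_cancel)
  qed
  have "(\<Sum>\<^sub>\<infinity>b\<in>{1..}. \<Sum>\<^sub>\<infinity>j\<in>{1..}. ennreal \<bar>row_entry x b j\<bar>)
      = (\<Sum>\<^sub>\<infinity>b\<in>{1..}. \<Sum>\<^sub>\<infinity>j\<in>{1..}. ennreal \<bar>p (b, j)\<bar>)"
    by (intro infsum_cong) (simp add: rows)
  also have "\<dots> < \<infinity>"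
    using link by (intro ennreal_iterated_sum_finite) (simp add: linked_def)
  finally show "x \<in> D" using gt by (simp add: D_def)
  show "A_val x = p"
  proof
    fix i :: "nat \<times> nat"
    obtain b j where i: "i = (b, j)" by fastforce
    have "p (b, 0) = 0" using link by (auto simp: linked_def l1_def idx_def)
    moreover have "p (0, j) = 0" if "j \<noteq> 0" "j \<noteq> 1"
      using link that by (auto simp: linked_def)
    ultimately show "A_val x i = p i"
      using rows[of b j] p01 by (auto simp: i A_val_def)
  qed
qed

lemma mem_gra_A_iff: "(x, a) \<in> gra A \<longleftrightarrow> (\<exists>p. a = l1_functional p \<and> graph_pair x p)"
  using graph_pair_A_val[of x] graph_pair_imp[of x]
  by (auto simp: gra_def A_def split: if_splits)

lemma mem_D_iff: "x \<in> D \<longleftrightarrow> (\<exists>p. graph_pair x p)"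
  using graph_pair_A_val graph_pair_imp by blast

text \<open>A graph pair for each \<open>t\<close> with \<open>|t| > 1\<close>. Its potentials vanish after the first entry of the row,
  so only the first column is occupied, and the boundary values \<open>1 / |t|^b\<close> are summable precisely
  because \<open>|t| > 1\<close>.\<close>

definition base_arg :: "real \<Rightarrow> c0" where
  "base_arg t = Abs_c0 (\<lambda>(b, j). if j \<noteq> 1 then 0 else if b = 0 then t else - (1 / (4 * \<bar>t\<bar>) ^ b))"

definition base_val :: "real \<Rightarrow> nat \<times> nat \<Rightarrow> real" where
  "base_val t = (\<lambda>(b, j). if j \<noteq> 1 then 0 else if b = 0 then t - sgn t else 1 / \<bar>t\<bar> ^ b)"

lemma finite_inverse_power_ge:
  fixes r e :: real
  assumes "r > 1" "e > 0"
  shows "finite {b::nat. 1 / r ^ b \<ge> e}"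
proof -
  have "(\<lambda>b. (1 / r) ^ b) \<longlonglongrightarrow> 0"
    using assms by (intro LIMSEQ_power_zero) (simp add: field_simps)
  then have "\<forall>\<^sub>F b in sequentially. (1 / r) ^ b < e"
    using order_tendstoD(2) assms(2) by blast
  then obtain N where "\<And>b. b \<ge> N \<Longrightarrow> (1 / r) ^ b < e"
    by (auto simp: eventually_sequentially)
  then have "{b. 1 / r ^ b \<ge> e} \<subseteq> {..<N}"
    by (auto simp: power_one_over not_le[symmetric])
  then show ?thesis using finite_subset by blast
qed

lemma coord_base_arg:
  assumes "\<bar>t\<bar> > 1"
  shows "coord (base_arg t) =
    (\<lambda>(b, j). if j \<noteq> 1 then 0 else if b = 0 then t else - (1 / (4 * \<bar>t\<bar>) ^ b))" (is "_ = ?f")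
proof -
  have "finite {i \<in> idx. \<bar>?f i\<bar> \<ge> e}" if "e > 0" for e
  proof (rule finite_subset)
    show "{i \<in> idx. \<bar>?f i\<bar> \<ge> e} \<subseteq> insert (0, 1) ((\<lambda>b. (b, 1)) ` {b. 1 / (4 * \<bar>t\<bar>) ^ b \<ge> e})"
      using that by (auto split: if_splits)
    show "finite (insert (0, 1) ((\<lambda>b. (b, 1)) ` {b. 1 / (4 * \<bar>t\<bar>) ^ b \<ge> e}))"
      using finite_inverse_power_ge[of "4 * \<bar>t\<bar>" e] assms that by simp
  qed
  then show ?thesis
    unfolding base_arg_def by (subst Abs_c0_inverse) (auto simp: idx_def)
qed

lemma base_val_l1:
  assumes "\<bar>t\<bar> > 1"
  shows "base_val t \<in> l1"
proof -
  have "summable (\<lambda>b. (1 / \<bar>t\<bar>) ^ b)"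
    using assms by (intro summable_geometric) simp
  then have "(\<lambda>b. (1 / \<bar>t\<bar>) ^ b) summable_on UNIV"
    by (intro norm_summable_imp_summable_on) (simp add: power_abs)
  then have "(\<lambda>b. (1 / \<bar>t\<bar>) ^ b) summable_on {1..}"
    by (rule summable_on_subset_banach) simp
  then have "(\<lambda>b. \<bar>base_val t (b, 1)\<bar>) summable_on {1..}"
    by (rule summable_on_cong[THEN iffD1, rotated]) (auto simp: base_val_def power_one_over)
  moreover have "insert 0 {1..} = (UNIV :: nat set)" by auto
  ultimately have "(\<lambda>b. \<bar>base_val t (b, 1)\<bar>) summable_on UNIV"
    by (metis summable_on_insert_iff)
  then have "(\<lambda>i. \<bar>base_val t i\<bar>) summable_on range (\<lambda>b. (b, 1))"
    by (subst summable_on_reindex) (auto simp: o_def intro: inj_onI)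
  then have "(\<lambda>i. \<bar>base_val t i\<bar>) summable_on idx"
    by (rule summable_on_cong_neutral[THEN iffD1, rotated -1])
       (auto simp: base_val_def idx_def split: if_splits)
  then show ?thesis by (auto simp: l1_def base_val_def idx_def)
qed

lemma graph_pair_base:
  assumes "\<bar>t\<bar> > 1"
  shows "graph_pair (base_arg t) (base_val t)"
  using base_val_l1[OF assms] assms
  by (auto simp: graph_pair_def linked_def boundary_def coord_base_arg base_val_def field_simps)

section \<open>Monotonicity\<close>

lemma abs_inverse_power_diff_le:
  fixes s t :: real
  assumes "s \<ge> 1" "t \<ge> 1"
  shows "\<bar>1 / s ^ b - 1 / t ^ b\<bar> \<le> real b * \<bar>s - t\<bar>"
proof (induction b)
  case (Suc b)
  have "1 / s ^ Suc b - 1 / t ^ Suc b = (1 / s ^ b - 1 / t ^ b) / s + (1 / t ^ b) * ((t - s) / (s * t))"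
    using assms by (simp add: field_simps)
  also have "\<bar>\<dots>\<bar> \<le> \<bar>1 / s ^ b - 1 / t ^ b\<bar> / s + \<bar>1 / t ^ b\<bar> * (\<bar>t - s\<bar> / (s * t))"
    using assms by (intro order_trans[OF abs_triangle_ineq]) (simp add: abs_mult)
  also have "\<dots> \<le> \<bar>1 / s ^ b - 1 / t ^ b\<bar> / 1 + 1 * (\<bar>t - s\<bar> / 1)"
    using assms mult_mono[of 1 s 1 t] by (intro add_mono mult_mono frac_le) auto
  also have "\<dots> \<le> real (Suc b) * \<bar>s - t\<bar>"
    using Suc by (simp add: algebra_simps)
  finally show ?case .
qed simp

lemma has_sum_square_over_power_4: "((\<lambda>b. (real b)\<^sup>2 / 4 ^ b) has_sum 20 / 27) {1..}"
proof -
  \<comment> \<open>The tail sum over indices above \<open>n\<close>: the ansatz of a quadratic polynomial over \<open>4 ^ n\<close> with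
    \<open>F n - F (n + 1)\<close> equal to the next term determines its coefficients.\<close>
  define F :: "nat \<Rightarrow> real" where "F n = ((real n)\<^sup>2 / 3 + 8 * real n / 9 + 20 / 27) / 4 ^ n" for n
  have "F \<longlonglongrightarrow> 0" unfolding F_def by real_asymp
  then have "(\<lambda>n. F n - F (Suc n)) sums (F 0 - 0)" by (rule telescope_sums')
  also have "(\<lambda>n. F n - F (Suc n)) = (\<lambda>n. (real (Suc n))\<^sup>2 / 4 ^ Suc n)"
    by (rule ext) (simp add: F_def field_simps power2_eq_square)
  finally have "(\<lambda>n. (real (Suc n))\<^sup>2 / 4 ^ Suc n) sums (20 / 27)" by (simp add: F_def)
  then show ?thesis
    unfolding has_sum_from_1_iff by (rule sums_nonneg_imp_has_sum) simp
qed

text \<open>On one branch this is an equality; across the branches, subtracting \<open>sgn\<close> shortens the distance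
  \<open>|s| + |t|\<close> by only \<open>2\<close>, which leaves room because \<open>|s|\<close> and \<open>|t|\<close> exceed \<open>1\<close>.\<close>

lemma sgn_shift_strongly_monotone:
  fixes s t :: real
  assumes "\<bar>s\<bar> > 1" "\<bar>t\<bar> > 1"
  shows "(\<bar>s\<bar> - \<bar>t\<bar>)\<^sup>2 \<le> (s - t) * ((s - sgn s) - (t - sgn t))"
proof -
  have same: "(\<bar>s\<bar> - \<bar>t\<bar>)\<^sup>2 \<le> (s - t) * ((s - sgn s) - (t - sgn t))" if "s > 1" "t > 1" for s t :: real
    using that by (simp add: power2_eq_square)
  have opp: "(\<bar>s\<bar> - \<bar>t\<bar>)\<^sup>2 \<le> (s - t) * ((s - sgn s) - (t - sgn t))" if "s > 1" "t < -1" for s t :: real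
  proof -
    have "(s - 1) * (- t - 1) \<ge> 0" using that by simp
    then show ?thesis using that by (simp add: power2_eq_square algebra_simps)
  qed
  consider "s > 1" "t > 1" | "s > 1" "t < -1" | "s < -1" "t > 1" | "s < -1" "t < -1"
    using assms by linarith
  then show ?thesis
  proof cases
    case 1 then show ?thesis by (rule same)
  next
    case 2 then show ?thesis by (rule opp)
  next
    case 3 then show ?thesis
      using opp[of t s] by (simp add: power2_eq_square algebra_simps)
  next
    case 4 then show ?thesis
      using same[of "-s" "-t"] by (simp add: power2_eq_square algebra_simps)
  qed
qed

lemma monotone_A: "monotone_op A"
proof -
  have "blinfun_apply (l1_functional p - l1_functional q) (x - y) \<ge> 0"
    if x: "graph_pair x p" and y: "graph_pair y q" for x y p q
  proof -
    let ?s = "coord x (0, 1)" and ?t = "coord y (0, 1)" and ?r = "\<lambda>i. p i - q i"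
    have link: "linked (x - y) ?r" and r: "p \<in> l1" "q \<in> l1"
      using x y linked_diff by (auto simp: graph_pair_def linked_def)
    have "(\<Sum>\<^sub>\<infinity>b\<in>{1..}. (boundary (x - y) ?r b)\<^sup>2 / 4 ^ b) \<le> 20 / 27 * (\<bar>?s\<bar> - \<bar>?t\<bar>)\<^sup>2"
    proof (rule has_sum_mono[OF has_sum_infsum])
      show "(\<lambda>b. (boundary (x - y) ?r b)\<^sup>2 / 4 ^ b) summable_on {1..}"
        using linked_pairing[OF link] by (auto simp: summable_on_def)
      show "((\<lambda>b. (real b)\<^sup>2 / 4 ^ b * (\<bar>?s\<bar> - \<bar>?t\<bar>)\<^sup>2) has_sum 20 / 27 * (\<bar>?s\<bar> - \<bar>?t\<bar>)\<^sup>2) {1..}"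
        by (rule has_sum_cmult_left[OF has_sum_square_over_power_4])
      fix b :: nat assume "b \<in> {1..}"
      then have "boundary (x - y) ?r b = 1 / \<bar>?s\<bar> ^ b - 1 / \<bar>?t\<bar> ^ b"
        using x y by (simp add: boundary_diff graph_pair_def)
      then have "(boundary (x - y) ?r b)\<^sup>2 \<le> (real b * \<bar>\<bar>?s\<bar> - \<bar>?t\<bar>\<bar>)\<^sup>2"
        using abs_inverse_power_diff_le[of "\<bar>?s\<bar>" "\<bar>?t\<bar>" b] x y
        by (intro abs_le_square_iff[THEN iffD1]) (auto simp: graph_pair_def)
      then show "(boundary (x - y) ?r b)\<^sup>2 / 4 ^ b \<le> (real b)\<^sup>2 / 4 ^ b * (\<bar>?s\<bar> - \<bar>?t\<bar>)\<^sup>2"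
        by (simp add: power_mult_distrib divide_right_mono)
    qed
    also have "\<dots> \<le> (\<bar>?s\<bar> - \<bar>?t\<bar>)\<^sup>2" by simp
    also have "\<dots> \<le> coord (x - y) (0, 1) * ?r (0, 1)"
      using sgn_shift_strongly_monotone[of ?s ?t] x y by (simp add: graph_pair_def)
    finally show ?thesis
      using infsumI[OF linked_pairing[OF link]] by (simp add: l1_functional_diff r)
  qed
  then show ?thesis by (auto simp: monotone_op_def mem_gra_A_iff)
qed

section \<open>Maximality\<close>

text \<open>Along \<open>x + m h\<close> the pairing is a polynomial in \<open>m\<close> whose quadratic coefficient, the pairing of
  \<open>h\<close> and \<open>r\<close>, vanishes. Being nonnegative for every real \<open>m\<close>, it has no linear term either.\<close>

lemma neutral_direction:
  assumes related: "\<And>x q. graph_pair x q \<Longrightarrow>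
      blinfun_apply (l1_functional p - l1_functional q) (z - x) \<ge> 0"
    and x: "graph_pair x q"
    and h: "linked h r" "coord h (0, 1) = 0" "r (0, 1) = 0" "\<And>b. b \<ge> 1 \<Longrightarrow> boundary h r b = 0"
  shows "blinfun_apply (l1_functional p - l1_functional q) h
    + blinfun_apply (l1_functional r) (z - x) = 0" (is "?K = 0")
proof (rule ccontr)
  assume "?K \<noteq> 0"
  have "((\<lambda>b. (boundary h r b)\<^sup>2 / 4 ^ b) has_sum 0) {1..}"
    by (rule has_sum_0) (simp add: h(4))
  then have rh: "blinfun_apply (l1_functional r) h = 0"
    using has_sum_unique[OF linked_pairing[OF h(1)]] h(2) by fastforce
  let ?c = "blinfun_apply (l1_functional p - l1_functional q) (z - x)"
  \<comment> \<open>The step at which the affine function \<open>?c - m * ?K\<close> takes the value \<open>-1\<close>.\<close>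
  define m where "m = (?c + 1) / ?K"
  have "graph_pair (x + m *\<^sub>R h) (\<lambda>i. q i + m * r i)"
    using x h by (auto simp: graph_pair_def linked_add_scale boundary_add_scale)
  from related[OF this]
  have "0 \<le> blinfun_apply (l1_functional p - (l1_functional q + m *\<^sub>R l1_functional r))
      (z - (x + m *\<^sub>R h))"
    using x h(1) by (simp add: l1_functional_add_scale graph_pair_def linked_def)
  also have "\<dots> = ?c - m * ?K + m\<^sup>2 * blinfun_apply (l1_functional r) h"
    by (simp add: blinfun.diff_left blinfun.diff_right blinfun.add_left blinfun.add_right
        blinfun.scaleR_left blinfun.scaleR_right algebra_simps power2_eq_square)
  also have "\<dots> = -1"
    using \<open>?K \<noteq> 0\<close> by (simp add: rh m_def)
  finally show False by simp
qed

text \<open>Two kinds of neutral directions suffice. A unit array in row \<open>0\<close>, paired with \<open>0\<close>, gives the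
  vanishing of \<open>p\<close> there; the sum of two neighbouring unit arrays in row \<open>b \<ge> 1\<close>, whose potential
  is supported strictly inside the row, gives the recurrence at that place.\<close>

lemma related_imp_linked:
  assumes p: "p \<in> l1"
    and related: "\<And>x q. graph_pair x q \<Longrightarrow>
      blinfun_apply (l1_functional p - l1_functional q) (z - x) \<ge> 0"
  shows "linked z p"
proof -
  obtain x q where x: "graph_pair x q" using graph_pair_base[of 2] by auto
  then have q: "q \<in> l1" and link: "linked x q" by (auto simp: graph_pair_def linked_def)
  show ?thesis
    unfolding linked_def
  proof (intro conjI allI impI p)
    fix j :: nat assume j: "j \<ge> 2"
    let ?h = "unit_c0 (0, j)"
    have "linked ?h (\<lambda>_. 0)"
      by (auto simp: linked_def l1_def coord_unit)
    then have "blinfun_apply (l1_functional p - l1_functional q) ?h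
        + blinfun_apply (l1_functional (\<lambda>_. 0)) (z - x) = 0"
      using j by (intro neutral_direction[OF related x]) (auto simp: boundary_def coord_unit)
    moreover have "blinfun_apply (l1_functional (\<lambda>_. 0)) (z - x) = 0"
      using l1_finite_support(2)[of "{}" "\<lambda>_. 0"] by simp
    ultimately show "p (0, j) = 0"
      using j link by (simp add: blinfun.diff_left l1_functional_unit p q idx_def linked_def)
  next
    fix b j :: nat assume b: "b \<ge> 1" and j: "j \<ge> 1"
    let ?h = "unit_c0 (b, j) + unit_c0 (b, Suc j)"
    define r :: "nat \<times> nat \<Rightarrow> real"
      where "r i = (if i = (b, j) then 4 ^ b else if i = (b, Suc j) then - (4 ^ b) else 0)" for i
    have i: "(b, j) \<in> idx" "(b, Suc j) \<in> idx" using j by (auto simp: idx_def)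
    have r: "r \<in> l1" "blinfun_apply (l1_functional r) y = 4 ^ b * (coord y (b, j) - coord y (b, Suc j))" for y
      using l1_finite_support(1)[of "{(b, j), (b, Suc j)}" r]
        l1_finite_support(2)[of "{(b, j), (b, Suc j)}" r y] i
      by (auto simp: r_def algebra_simps)
    have "linked ?h r"
      using r(1) b i by (auto simp: linked_def r_def coord_unit)
    then have "blinfun_apply (l1_functional p - l1_functional q) ?h
        + blinfun_apply (l1_functional r) (z - x) = 0"
      using b j i by (intro neutral_direction[OF related x]) (auto simp: boundary_def coord_unit r_def)
    moreover have "q (b, j) + q (b, Suc j) = 4 ^ b * (coord x (b, Suc j) - coord x (b, j))"
      using link b j by (simp add: linked_def)
    ultimately show "p (b, j) + p (b, Suc j) = 4 ^ b * (coord z (b, Suc j) - coord z (b, j))"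
      by (simp add: blinfun.diff_left blinfun.add_right l1_functional_unit p q i r(2) algebra_simps)
  qed
qed

text \<open>The function \<open>t - sgn t\<close> on \<open>|t| > 1\<close> is increasing, and its one-sided limits at \<open>-1\<close> and \<open>1\<close> are
  both \<open>0\<close>. A related point therefore lies on its graph or on the horizontal segment that bridges
  the gap.\<close>

lemma sgn_shift_maximal:
  fixes \<tau> \<pi> :: real
  assumes related: "\<And>t. \<bar>t\<bar> > 1 \<Longrightarrow> (\<tau> - t) * (\<pi> - (t - sgn t)) \<ge> 0"
  shows "\<bar>\<tau>\<bar> > 1 \<Longrightarrow> \<pi> = \<tau> - sgn \<tau>" and "\<bar>\<tau>\<bar> \<le> 1 \<Longrightarrow> \<pi> = 0"
proof -
  have pos: "\<pi> = \<tau> - 1"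
    if "\<tau> > 1" and rel: "\<And>t. t > 1 \<Longrightarrow> (\<tau> - t) * (\<pi> - (t - 1)) \<ge> 0" for \<tau> \<pi> :: real
  proof (rule ccontr)
    assume "\<pi> \<noteq> \<tau> - 1"
    then consider "\<pi> > \<tau> - 1" | "\<pi> < \<tau> - 1" by linarith
    then show False
    proof cases
      case 1
      define t where "t = (\<tau> + \<pi> + 1) / 2"
      have "\<tau> - t < 0" "\<pi> - (t - 1) > 0" "t > 1" using 1 \<open>\<tau> > 1\<close> by (auto simp: t_def)
      then show False using rel[of t] by (auto simp: zero_le_mult_iff)
    next
      case 2
      define t where "t = max ((\<tau> + \<pi> + 1) / 2) ((\<tau> + 1) / 2)"
      have "\<tau> - t > 0" "\<pi> - (t - 1) < 0" "t > 1" using 2 \<open>\<tau> > 1\<close> by (auto simp: t_def max_def)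
      then show False using rel[of t] by (auto simp: zero_le_mult_iff)
    qed
  qed
  show "\<pi> = \<tau> - sgn \<tau>" if "\<bar>\<tau>\<bar> > 1"
  proof (cases "\<tau> > 0")
    case True
    have "\<pi> = \<tau> - 1"
    proof (rule pos)
      show "(\<tau> - t) * (\<pi> - (t - 1)) \<ge> 0" if "t > 1" for t
        using related[of t] that by simp
    qed (use that True in auto)
    then show ?thesis using that True by simp
  next
    case False
    have "- \<pi> = - \<tau> - 1"
    proof (rule pos)
      show "(- \<tau> - t) * (- \<pi> - (t - 1)) \<ge> 0" if "t > 1" for t
        using related[of "- t"] that by (simp add: algebra_simps)
    qed (use that False in auto)
    then show ?thesis using that False by simp
  qed
  show "\<pi> = 0" if "\<bar>\<tau>\<bar> \<le> 1"
  proof (rule ccontr)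
    assume "\<pi> \<noteq> 0"
    then consider "\<pi> > 0" | "\<pi> < 0" by linarith
    then show False
    proof cases
      case 1
      have "\<tau> - (1 + \<pi> / 2) < 0" "\<pi> - (\<pi> / 2) > 0" using 1 that by auto
      then show False using related[of "1 + \<pi> / 2"] 1 by (auto simp: zero_le_mult_iff)
    next
      case 2
      have "\<tau> - (- 1 + \<pi> / 2) > 0" "\<pi> - (\<pi> / 2) < 0" using 2 that by auto
      then show False using related[of "- 1 + \<pi> / 2"] 2 by (auto simp: zero_le_mult_iff)
    qed
  qed
qed

text \<open>Comparing \<open>(z, p)\<close> with the base pairs bounds each squared deviation of a boundary value from
  \<open>1 / |t|^b\<close> by the scalar product of \<open>sgn_shift_maximal\<close>. The choice \<open>t = z (0, 1)\<close> makes that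
  product vanish outside the gap; inside the gap it vanishes in the limit \<open>t \<rightarrow> 1\<close>.\<close>

lemma related_imp_graph_pair:
  assumes p: "p \<in> l1"
    and related: "\<And>x q. graph_pair x q \<Longrightarrow>
      blinfun_apply (l1_functional p - l1_functional q) (z - x) \<ge> 0"
  shows "graph_pair z p"
proof -
  have link: "linked z p" using related_imp_linked[OF assms] .
  let ?\<tau> = "coord z (0, 1)" and ?\<pi> = "p (0, 1)"
  have defect: "(boundary z p b - 1 / \<bar>t\<bar> ^ b)\<^sup>2 / 4 ^ b \<le> (?\<tau> - t) * (?\<pi> - (t - sgn t))"
    if t: "\<bar>t\<bar> > 1" and b: "b \<ge> 1" for t b
  proof -
    let ?x = "base_arg t" and ?q = "base_val t"
    have x: "graph_pair ?x ?q" using t by (rule graph_pair_base)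
    then have q: "?q \<in> l1" and x01: "coord ?x (0, 1) = t"
      using t by (auto simp: graph_pair_def linked_def coord_base_arg)
    have lk: "linked (z - ?x) (\<lambda>i. p i - ?q i)"
      using link x by (auto simp: graph_pair_def intro: linked_diff)
    have "(boundary z p b - 1 / \<bar>t\<bar> ^ b)\<^sup>2 / 4 ^ b
        = (\<Sum>b\<in>{b}. (boundary (z - ?x) (\<lambda>i. p i - ?q i) b)\<^sup>2 / 4 ^ b)"
      using x b by (simp add: boundary_diff graph_pair_def x01[simplified])
    also have "\<dots> \<le> coord (z - ?x) (0, 1) * (?\<pi> - ?q (0, 1))
        - blinfun_apply (l1_functional (\<lambda>i. p i - ?q i)) (z - ?x)"
      by (rule finite_sum_le_has_sum[OF linked_pairing[OF lk]]) (use b in auto)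
    also have "\<dots> \<le> (?\<tau> - t) * (?\<pi> - (t - sgn t))"
      using related[OF x] x by (simp add: l1_functional_diff p q x01[simplified] graph_pair_def)
    finally show ?thesis .
  qed
  have scalar: "(?\<tau> - t) * (?\<pi> - (t - sgn t)) \<ge> 0" if "\<bar>t\<bar> > 1" for t
    using defect[OF that, of 1] by (intro order_trans[OF _ defect[OF that, of 1]]) auto
  show ?thesis
  proof (cases "\<bar>?\<tau>\<bar> > 1")
    case True
    have "boundary z p b = 1 / \<bar>?\<tau>\<bar> ^ b" if "b \<ge> 1" for b
      using defect[OF True that] zero_less_power[of "4::real" b]
      by (auto simp: divide_le_0_iff simp del: zero_less_power)
    then show ?thesis
      using True link sgn_shift_maximal(1)[OF scalar True] by (simp add: graph_pair_def)
  next
    case False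
    then have \<pi>: "?\<pi> = 0" using sgn_shift_maximal(2)[OF scalar] by simp
    have bd: "boundary z p b = 1" if "b \<ge> 1" for b
    proof -
      have "(boundary z p b - 1 / \<bar>1\<bar> ^ b)\<^sup>2 / 4 ^ b \<le> (?\<tau> - 1) * (0 - (1 - 1))"
      proof (rule tendsto_le[of "at_right (1::real)"])
        show "((\<lambda>t. (boundary z p b - 1 / \<bar>t\<bar> ^ b)\<^sup>2 / 4 ^ b)
            \<longlongrightarrow> (boundary z p b - 1 / \<bar>1\<bar> ^ b)\<^sup>2 / 4 ^ b) (at_right 1)"
          by (intro tendsto_intros) auto
        show "((\<lambda>t. (?\<tau> - t) * (0 - (t - 1))) \<longlongrightarrow> (?\<tau> - 1) * (0 - (1 - 1))) (at_right 1)"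
          by (intro tendsto_intros)
        have "\<forall>\<^sub>F t in at_right (1::real). t > 1"
          by (simp add: eventually_at_right_less)
        then show "\<forall>\<^sub>F t in at_right 1. (boundary z p b - 1 / \<bar>t\<bar> ^ b)\<^sup>2 / 4 ^ b
            \<le> (?\<tau> - t) * (0 - (t - 1))"
        proof eventually_elim
          case (elim t)
          then show ?case using defect[of t b] that \<pi> by simp
        qed
      qed simp
      then show ?thesis
        using zero_less_power[of "4::real" b] by (auto simp: divide_le_0_iff simp del: zero_less_power)
    qed
    have "(\<lambda>n. boundary z p (Suc n)) summable_on UNIV"
      using linked_boundary_summable[OF link] has_sum_from_1_iff[of "boundary z p"]
      by (auto simp: summable_on_def)
    then have "(\<lambda>n. boundary z p (Suc n)) \<longlonglongrightarrow> 0"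
      by (intro summable_LIMSEQ_zero summable_on_imp_summable)
    then show ?thesis by (simp add: bd LIMSEQ_const_iff)
  qed
qed

lemma maximally_monotone_A: "maximally_monotone A"
  unfolding maximally_monotone_def
proof (intro conjI monotone_A allI impI)
  fix z \<phi> assume rel: "\<forall>(x, a)\<in>gra A. 0 \<le> blinfun_apply (\<phi> - a) (z - x)"
  obtain p where p: "p \<in> l1" "\<phi> = l1_functional p"
    using l1_functional_bij by (auto simp: bij_betw_def)
  have "graph_pair z p"
    by (rule related_imp_graph_pair[OF p(1)]) (use rel in \<open>auto simp: mem_gra_A_iff p(2)\<close>)
  then show "(z, \<phi>) \<in> gra A" using p(2) by (auto simp: mem_gra_A_iff)
qed

section \<open>The domain and the failure of type (FPV)\<close>

lemma bounded_linear_coord: "bounded_linear (\<lambda>x. coord x i)"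
  by (rule bounded_linear_intro[where K = 1]) (simp_all add: coord_le_norm)

lemma continuous_on_coord: "continuous_on S (\<lambda>x. coord x i)"
  by (rule bounded_linear.continuous_on[OF bounded_linear_coord continuous_on_id])

lemma coord_image_D: "(\<lambda>x. coord x (0, 1)) ` D = {..<-1} \<union> {1<..}"
proof
  show "(\<lambda>x. coord x (0, 1)) ` D \<subseteq> {..<-1} \<union> {1<..}"
    by (auto simp: D_def)
  show "{..<-1} \<union> {1<..} \<subseteq> (\<lambda>x. coord x (0, 1)) ` D"
  proof
    fix t :: real assume "t \<in> {..<-1} \<union> {1<..}"
    then have "\<bar>t\<bar> > 1" by auto
    then have "base_arg t \<in> D" "coord (base_arg t) (0, 1) = t"
      using graph_pair_base mem_D_iff by (auto simp: coord_base_arg)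
    then show "t \<in> (\<lambda>x. coord x (0, 1)) ` D" by force
  qed
qed

text \<open>The closure stays in \<open>|x (0, 1)| \<ge> 1\<close>, so it misses midpoints between the two branches.\<close>

lemma closure_D_not_convex: "\<not> convex (closure D)"
proof
  assume "convex (closure D)"
  moreover have "base_arg t \<in> closure D" if "\<bar>t\<bar> > 1" for t
    using graph_pair_base[OF that] mem_D_iff closure_subset by blast
  ultimately have "(1/2) *\<^sub>R base_arg 2 + (1/2) *\<^sub>R base_arg (-2) \<in> closure D"
    by (intro convexD) auto
  moreover have "closure D \<subseteq> {x. \<bar>coord x (0, 1)\<bar> \<ge> 1}"
    by (rule closure_minimal)
       (auto simp: D_def intro!: closed_Collect_le continuous_intros continuous_on_coord)
  ultimately show False by (auto simp: coord_base_arg)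
qed

text \<open>In the half space \<open>x (0, 1) > -1\<close> a graph pair has \<open>t = x (0, 1) > 1\<close>. The test pair is the
  base pair for \<open>t = 2\<close> with its entries at \<open>(0, 1)\<close> replaced by \<open>0\<close> in the argument and by \<open>-100\<close> in the
  functional. The boundary values of both pairs lie in \<open>[0, 1]\<close>, so the square sum of their
  differences is at most \<open>20/27\<close>, while the scalar term becomes \<open>t (99 + t)\<close>.\<close>

lemma not_type_FPV_A: "\<not> type_FPV A"
proof
  assume FPV: "type_FPV A"
  define U where "U = {x. coord x (0, 1) > -1}"
  have "open U"
    unfolding U_def by (intro open_Collect_less continuous_on_coord continuous_on_const)
  moreover have "convex U"
    using convex_linear_vimage[OF bounded_linear.linear[OF bounded_linear_coord] convex_real_interval(3)]
    by (simp add: U_def vimage_def)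
  moreover have "base_arg 2 \<in> U \<inter> op_dom A"
    using graph_pair_base[of 2] mem_D_iff by (auto simp: U_def coord_base_arg op_dom_A)
  ultimately have local: "(z, \<phi>) \<in> gra A"
    if "z \<in> U" "\<And>x a. (x, a) \<in> gra A \<Longrightarrow> x \<in> U \<Longrightarrow> blinfun_apply (\<phi> - a) (z - x) \<ge> 0" for z \<phi>
    using FPV that unfolding type_FPV_def by blast
  \<comment> \<open>The entry of \<open>base_val 2\<close> at \<open>(0, 1)\<close> is \<open>1\<close>, so subtracting \<open>d\<close> leaves \<open>-100\<close> there; any
    sufficiently negative number would do.\<close>
  define d :: "nat \<times> nat \<Rightarrow> real" where "d i = (if i = (0, 1) then 101 else 0)" for i
  define z where "z = base_arg 2 - 2 *\<^sub>R unit_c0 (0, 1)"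
  define p where "p i = base_val 2 i - d i" for i
  have "d \<in> l1"
    by (rule l1_finite_support(1)[of "{(0, 1)}"]) (auto simp: d_def idx_def)
  then have "linked (2 *\<^sub>R unit_c0 (0, 1)) d"
    by (auto simp: linked_def d_def coord_unit)
  then have link: "linked z p"
    using graph_pair_base[of 2] unfolding z_def p_def
    by (intro linked_diff) (simp_all add: graph_pair_def)
  have z01: "coord z (0, 1) = 0"
    by (simp add: z_def coord_base_arg coord_unit idx_def)
  have p01: "p (0, 1) = - 100" by (simp add: p_def d_def base_val_def)
  have bd: "boundary z p b = 1 / 2 ^ b" if "b \<ge> 1" for b
  proof -
    have "boundary (2 *\<^sub>R unit_c0 (0, 1)) d b = 0"
      using that by (simp add: boundary_def coord_unit d_def)
    then show ?thesis
      using that graph_pair_base[of 2] boundary_diff[of "base_arg 2" "2 *\<^sub>R unit_c0 (0, 1)" "base_val 2" d b]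
      by (simp add: z_def p_def[abs_def] graph_pair_def coord_base_arg)
  qed
  have "(z, l1_functional p) \<in> gra A"
  proof (rule local)
    show "z \<in> U" unfolding U_def mem_Collect_eq z01 by simp
    fix x a assume "(x, a) \<in> gra A" and "x \<in> U"
    then obtain q where a: "a = l1_functional q" and x: "graph_pair x q"
      by (auto simp: mem_gra_A_iff)
    let ?t = "coord x (0, 1)"
    have t: "?t > 1" using x \<open>x \<in> U\<close> by (auto simp: graph_pair_def U_def)
    have lk: "linked (z - x) (\<lambda>i. p i - q i)"
      using link x by (auto simp: graph_pair_def intro: linked_diff)
    have "coord (z - x) (0, 1) * (p (0, 1) - q (0, 1))
        - blinfun_apply (l1_functional (\<lambda>i. p i - q i)) (z - x) \<le> 20 / 27"
    proof (rule has_sum_mono[OF linked_pairing[OF lk] has_sum_square_over_power_4])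
      fix b :: nat assume b: "b \<in> {1..}"
      have "boundary (z - x) (\<lambda>i. p i - q i) b = 1 / 2 ^ b - 1 / ?t ^ b"
        using b x t by (simp add: boundary_diff bd graph_pair_def)
      moreover have "0 \<le> 1 / ?t ^ b" "1 / ?t ^ b \<le> 1" "0 \<le> 1 / (2::real) ^ b" "1 / (2::real) ^ b \<le> 1"
        using t by (auto simp: one_le_power)
      ultimately have "\<bar>boundary (z - x) (\<lambda>i. p i - q i) b\<bar> \<le> 1" by linarith
      then have "\<bar>boundary (z - x) (\<lambda>i. p i - q i) b\<bar> \<le> \<bar>real b\<bar>"
        using b by simp
      then show "(boundary (z - x) (\<lambda>i. p i - q i) b)\<^sup>2 / 4 ^ b \<le> (real b)\<^sup>2 / 4 ^ b"
        by (intro divide_right_mono abs_le_square_iff[THEN iffD1]) auto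
    qed
    moreover have "coord (z - x) (0, 1) * (p (0, 1) - q (0, 1)) = ?t * (99 + ?t)"
    proof -
      have q01: "q (0, 1) = ?t - 1" using x t by (simp add: graph_pair_def)
      show ?thesis unfolding coord_minus z01 p01 q01 by (simp add: algebra_simps)
    qed
    moreover have "?t * (99 + ?t) \<ge> 1 * 1"
      using t by (intro mult_mono) auto
    ultimately show "blinfun_apply (l1_functional p - a) (z - x) \<ge> 0"
      using link x by (simp add: a l1_functional_diff linked_def graph_pair_def)
  qed
  then show False using z01 by (auto simp: mem_gra_A_iff graph_pair_def)
qed

theorem theorem1:
  shows "op_dom A \<noteq> {} \<and> maximally_monotone A \<and> \<not> type_FPV A
    \<and> (\<lambda>x. coord x (0, 1)) ` D = {..<-1} \<union> {1<..}
    \<and> \<not> convex (closure (op_dom A))"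
proof -
  have "D \<noteq> {}" using coord_image_D by auto
  then show ?thesis
    using maximally_monotone_A not_type_FPV_A coord_image_D closure_D_not_convex
    by (simp add: op_dom_A)
qed

end
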